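(* Let $u:\mathbb R^n\to\mathbb R$ be a function whose graph is an entire spacelike hypersurface of $\mathbb R^{n,1}$. Let $$L=\Big\{\theta\in\mathbb S^{n-1}\ :\ \lim_{r\to+\infty}\tfrac{u(r\theta)}{r}=1\Big\},\qquad f_0(\theta)=\lim_{r\to+\infty}\big(r-u(r\theta)\big)\in\mathbb R\cup\{+\infty\}\quad\text{for }\theta\in L,$$ and let $\varphi(\theta)=\sup_{\mathbf y\in\mathbb R^n}\big(\theta\cdot\mathbf y-u(\mathbf y)\big)$ be the null support function of $u$. Then $$\varphi(\theta)=\begin{cases}f_0(\theta)&\text{for }\theta\in L,\\ +\infty&\text{for }\theta\in\mathbb S^{n-1}\setminus L.\end{cases}$$ Moreover, if the graph of $u$ has mean curvature bounded below by a positive constant $H$, then $L$ is the closure of the set $\{\theta\in\mathbb S^{n-1}:\varphi(\theta)<+\infty\}$.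
   Context: Minkowski space $\mathbb R^{n,1}$ ($n\ge 1$) is $\mathbb R^{n+1}$ with $dx_1^2+\dots+dx_n^2-dx_{n+1}^2$. A spacelike hypersurface is a smooth connected hypersurface on which the induced metric is Riemannian; it is entire if it is the graph $\{x_{n+1}=u(\mathbf x)\}$ of a function on all of $\mathbb R^n$. The mean curvature is $\frac1n\mathrm{tr}(d\nu)$, where $\nu$ is the future-directed unit normal (positive last coordinate), so that the future unit hyperboloid has mean curvature $1$. *)

theory Defs
  imports "HOL-Analysis.Analysis"
begin

text \<open>
  Minkowski space of signature (n, 1) is modelled by the type \<open>(real ^ 'n) \<times> real\<close> with
  n = \<open>CARD('n)\<close>; the second component is the time coordinate.
\<close>

definition minkowski :: "(real ^ 'n) \<times> real \<Rightarrow> (real ^ 'n) \<times> real \<Rightarrow> real" where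
  "minkowski v w = fst v \<bullet> fst w - snd v * snd w"

text \<open>
  Smoothness on an open set: the iterated directional derivatives of all orders exist and are
  differentiable.
\<close>

primrec Ck_on :: "nat \<Rightarrow> 'a::euclidean_space set \<Rightarrow> ('a \<Rightarrow> 'b::real_normed_vector) \<Rightarrow> bool" where
  "Ck_on 0 U f \<longleftrightarrow> continuous_on U f"
| "Ck_on (Suc k) U f \<longleftrightarrow> (\<forall>x\<in>U. f differentiable (at x)) \<and>
     (\<forall>v. Ck_on k U (\<lambda>x. frechet_derivative f (at x) v))"

definition smooth_on :: "'a::euclidean_space set \<Rightarrow> ('a \<Rightarrow> 'b::real_normed_vector) \<Rightarrow> bool" where
  "smooth_on U f \<longleftrightarrow> (\<forall>k. Ck_on k U f)"

definition smooth_hypersurface :: "'a::euclidean_space set \<Rightarrow> bool" where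
  "smooth_hypersurface S \<longleftrightarrow>
     (\<forall>p\<in>S. \<exists>U (g :: 'a \<Rightarrow> real). open U \<and> p \<in> U \<and> smooth_on U g \<and>
        (\<forall>q\<in>U. \<exists>v. frechet_derivative g (at q) v \<noteq> 0) \<and>
        S \<inter> U = {q \<in> U. g q = 0})"

text \<open>Velocities at \<open>p\<close> of curves in \<open>S\<close> that pass through \<open>p\<close> at time 0.\<close>

definition tangent_space :: "'a::euclidean_space set \<Rightarrow> 'a \<Rightarrow> 'a set" where
  "tangent_space S p =
     {v. \<exists>c. c 0 = p \<and> (\<forall>\<^sub>F t in at 0. c t \<in> S) \<and> (c has_vector_derivative v) (at 0)}"

definition spacelike_hypersurface :: "((real ^ 'n) \<times> real) set \<Rightarrow> bool" where
  "spacelike_hypersurface S \<longleftrightarrow>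
     S \<noteq> {} \<and> connected S \<and> smooth_hypersurface S \<and>
     (\<forall>p\<in>S. \<forall>v\<in>tangent_space S p. v \<noteq> 0 \<longrightarrow> minkowski v v > 0)"

definition graph_of :: "(real ^ 'n \<Rightarrow> real) \<Rightarrow> ((real ^ 'n) \<times> real) set" where
  "graph_of u = {(x, u x) | x. True}"

definition unit_normal :: "((real ^ 'n) \<times> real) set \<Rightarrow> (real ^ 'n) \<times> real \<Rightarrow> (real ^ 'n) \<times> real" where
  "unit_normal S p =
     (THE \<nu>. (\<forall>v\<in>tangent_space S p. minkowski \<nu> v = 0) \<and> minkowski \<nu> \<nu> = - 1 \<and> snd \<nu> > 0)"

text \<open>
  The trace of an endomorphism \<open>A\<close> of a subspace \<open>V\<close>; it does not depend on the chosen basis.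
\<close>

definition trace_on :: "'a::euclidean_space set \<Rightarrow> ('a \<Rightarrow> 'a) \<Rightarrow> real" where
  "trace_on V A =
     (let B = (SOME B. B \<subseteq> V \<and> independent B \<and> V \<subseteq> span B)
      in \<Sum>b\<in>B. representation B (A b) b)"

text \<open>
  The normal field is a map on \<open>S\<close> only, so it is differentiated within \<open>S\<close>. This determines
  the derivative on the tangent space (not on all of \<open>(real ^ 'n) \<times> real\<close>), which is all the trace
  depends on.
\<close>

definition mean_curvature :: "((real ^ 'n) \<times> real) set \<Rightarrow> (real ^ 'n) \<times> real \<Rightarrow> real" where
  "mean_curvature S p =
     trace_on (tangent_space S p) (frechet_derivative (unit_normal S) (at p within S))
       / real CARD('n)"

definition lightlike_directions :: "(real ^ 'n \<Rightarrow> real) \<Rightarrow> (real ^ 'n) set" where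
  "lightlike_directions u = {\<theta> \<in> sphere 0 1. ((\<lambda>r. u (r *\<^sub>R \<theta>) / r) \<longlongrightarrow> 1) at_top}"

definition asymptotic_offset :: "(real ^ 'n \<Rightarrow> real) \<Rightarrow> real ^ 'n \<Rightarrow> ereal" where
  "asymptotic_offset u \<theta> = Lim at_top (\<lambda>r::real. ereal (r - u (r *\<^sub>R \<theta>)))"

definition null_support :: "(real ^ 'n \<Rightarrow> real) \<Rightarrow> real ^ 'n \<Rightarrow> ereal" where
  "null_support u \<theta> = (SUP y. ereal (\<theta> \<bullet> y - u y))"

end

theory Submission
  imports Defs
begin

text \<open>
  Near each of its points the graph is a level set of a smooth function \<open>g\<close>. Vertical vectors are
  timelike and therefore not tangent to the graph, so the time derivative of \<open>g\<close> does not vanish, and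
  \<open>u\<close> is differentiable with differentiable gradient \<open>gradient u\<close>
  (\<open>spacelike_graph_gradient_differentiable\<close>). Since the tangent vector over the gradient is
  spacelike, the gradient is shorter than 1, and \<open>u\<close> is 1-Lipschitz.

  The Lipschitz bound alone gives the formula for the null support function. The graph lies below
  the light cone of each of its points, and along the ray of \<open>\<theta>\<close> a light cone is asymptotic to a
  null hyperplane; hence \<open>r - u (r *\<^sub>R \<theta>)\<close> tends to the null support in every direction
  (\<open>tendsto_null_support\<close>). If the limit is finite, division by \<open>r\<close> shows that \<open>\<theta>\<close> is lightlike. The
  Lipschitz bound also makes the set of lightlike directions closed.

  The remaining inclusion needs the mean curvature bound \<open>H > 0\<close>. A hyperboloid of radius
  \<open>R > 1 / H\<close> has mean curvature less than \<open>H\<close>, so by the maximum principle no translate of it can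
  touch the graph from above (\<open>mean_curvature_le_at_contact_with_hyperboloid\<close>). If the centre
  \<open>(x0, t0)\<close> is in the future of all null support hyperplanes, the hyperboloid is above the graph near
  infinity, hence everywhere, and \<open>u x0 < t0 + R\<close>
  (\<open>height_less_if_mean_curvature_bounded_below\<close>). So the graph stays within bounded height of the
  envelope of its null support hyperplanes. If the null support is infinite on a neighbourhood of a
  direction, this envelope has slope less than 1 along the direction, which is therefore
  not lightlike (\<open>lightlike_directions_subset_closure\<close>).
\<close>

section \<open>Regularity of spacelike graphs\<close>

text \<open>
  The existence half of the implicit function theorem, from a first-order expansion at
  the single point \<open>p\<close>: near \<open>p\<close> the value of \<open>g\<close> at \<open>p + h + s *\<^sub>R w\<close> is \<open>s * G w\<close> up to an error
  of at most \<open>e * norm h * \<bar>G w\<bar>\<close>, so \<open>g\<close> has opposite weak signs at \<open>s = - e * norm h\<close> and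
  \<open>s = e * norm h\<close>, and the intermediate value theorem gives a zero in between. With \<open>w\<close> any
  transversal vector this yields curves in the level set, and with \<open>w\<close> the time direction it yields the
  differentiability of a function whose graph is the level set.
\<close>
lemma zero_set_near_kernel:
  fixes g :: "'a::real_normed_vector \<Rightarrow> real"
  assumes "open U" "p \<in> U" "continuous_on U g" "g p = 0"
    and G: "(g has_derivative G) (at p)" and w: "G w \<noteq> 0" and e: "e > 0"
  obtains d where "d > 0"
    and "\<And>h. G h = 0 \<Longrightarrow> norm h < d \<Longrightarrow>
           \<exists>s. \<bar>s\<bar> \<le> e * norm h \<and> p + h + s *\<^sub>R w \<in> U \<and> g (p + h + s *\<^sub>R w) = 0"
proof -
  interpret G: bounded_linear G
    using G by (rule has_derivative_bounded_linear)
  define C where "C = 1 + e * norm w"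
  have C: "C > 0"
    using e by (simp add: C_def add_pos_nonneg)
  obtain \<rho> where \<rho>: "\<rho> > 0" "ball p \<rho> \<subseteq> U"
    using assms(1,2) open_contains_ball by blast
  \<comment> \<open>The points \<open>p + h + s *\<^sub>R w\<close> in question are within \<open>C * norm h\<close> of \<open>p\<close>; this error bound
    makes the linear term \<open>s * G w\<close> dominate at the two endpoints.\<close>
  have "e * \<bar>G w\<bar> / C > 0"
    using e w C by simp
  then obtain \<delta> where \<delta>: "\<delta> > 0"
    "\<And>q. norm (q - p) < \<delta> \<Longrightarrow> \<bar>g q - G (q - p)\<bar> \<le> e * \<bar>G w\<bar> / C * norm (q - p)"
    using G[unfolded has_derivative_at_alt] assms(4) by fastforce
  show thesis
  proof
    show "min \<rho> \<delta> / C > 0"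
      using \<rho> \<delta> C by simp
    fix h assume h: "G h = 0" "norm h < min \<rho> \<delta> / C"
    define m where "m = e * norm h"
    have Ch: "C * norm h < \<rho>" "C * norm h < \<delta>"
      using h(2) C by (simp_all add: field_simps)
    have small: "norm (h + s *\<^sub>R w) \<le> C * norm h" if "\<bar>s\<bar> \<le> m" for s
    proof -
      have "norm (h + s *\<^sub>R w) \<le> norm h + \<bar>s\<bar> * norm w"
        using norm_triangle_ineq[of h "s *\<^sub>R w"] by simp
      also have "\<dots> \<le> norm h + m * norm w"
        using that by (simp add: mult_right_mono)
      finally show ?thesis
        by (simp add: C_def m_def algebra_simps)
    qed
    have inU: "p + h + s *\<^sub>R w \<in> U" if "\<bar>s\<bar> \<le> m" for s
    proof -
      have "dist p (p + h + s *\<^sub>R w) = norm (h + s *\<^sub>R w)"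
        by (metis add.assoc add_diff_cancel_left' dist_commute dist_norm)
      then show ?thesis
        using small[OF that] Ch(1) \<rho>(2) by (metis le_less_trans mem_ball subsetD)
    qed
    have est: "\<bar>g (p + h + s *\<^sub>R w) - s * G w\<bar> \<le> m * \<bar>G w\<bar>" if "\<bar>s\<bar> \<le> m" for s
    proof -
      let ?q = "p + h + s *\<^sub>R w"
      have q: "?q - p = h + s *\<^sub>R w"
        by simp
      have "\<bar>g ?q - G (?q - p)\<bar> \<le> e * \<bar>G w\<bar> / C * norm (?q - p)"
        using small[OF that] Ch(2) by (intro \<delta>(2)) (simp add: q)
      also have "\<dots> \<le> e * \<bar>G w\<bar> / C * (C * norm h)"
        unfolding q using small[OF that] e C by (intro mult_left_mono) auto
      also have "\<dots> = m * \<bar>G w\<bar>"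
        using C by (simp add: m_def)
      finally show ?thesis
        unfolding q by (simp add: G.add G.scaleR h(1))
    qed
    have m: "0 \<le> m"
      using e by (simp add: m_def)
    let ?f = "\<lambda>s. g (p + h + s *\<^sub>R w) * G w"
    have "?f (-m) \<le> 0 \<and> 0 \<le> ?f m"
    proof (cases "G w > 0")
      case True
      then show ?thesis
        using est[of m] est[of "-m"] m
        by (auto simp: zero_le_mult_iff mult_le_0_iff)
    next
      case False
      then have "G w < 0"
        using w by simp
      then show ?thesis
        using est[of m] est[of "-m"] m
        by (auto simp: zero_le_mult_iff mult_le_0_iff)
    qed
    moreover have "continuous_on {-m..m} ?f"
      by (intro continuous_intros continuous_on_compose2[OF assms(3)]) (auto intro!: inU)
    ultimately obtain s where "-m \<le> s" "s \<le> m" "?f s = 0"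
      using IVT'[of ?f "-m" 0 m] m by auto
    then show "\<exists>s. \<bar>s\<bar> \<le> e * norm h \<and> p + h + s *\<^sub>R w \<in> U \<and> g (p + h + s *\<^sub>R w) = 0"
      using w inU[of s] by (intro exI[of _ s]) (auto simp: m_def)
  qed
qed

text \<open>
  A tangent vector asks for a curve, but it need not be continuous away from time 0. It is enough to
  pick points of \<open>S\<close> that are nearest to \<open>p + t *\<^sub>R v\<close> up to \<open>t\<^sup>2\<close>: the zeros found near the kernel show that
  their distance to \<open>p + t *\<^sub>R v\<close> is \<open>o(t)\<close>.
\<close>
lemma kernel_subset_tangent_space:
  fixes g :: "'a::euclidean_space \<Rightarrow> real"
  assumes U: "open U" "p \<in> U" "continuous_on U g" and S: "S \<inter> U = {q \<in> U. g q = 0}"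
    and G: "(g has_derivative G) (at p)" and p: "p \<in> S" and w: "G w \<noteq> 0" and v: "G v = 0"
  shows "v \<in> tangent_space S p"
proof -
  have "\<exists>q. q \<in> S \<and> dist (p + t *\<^sub>R v) q < infdist (p + t *\<^sub>R v) S + t\<^sup>2" if "t \<noteq> 0" for t
  proof -
    have "S \<noteq> {}" "infdist (p + t *\<^sub>R v) S < infdist (p + t *\<^sub>R v) S + t\<^sup>2"
      using p that by auto
    then show ?thesis
      unfolding infdist_notempty[OF \<open>S \<noteq> {}\<close>] by (subst (asm) cINF_less_iff) auto
  qed
  then obtain c' where c': "\<And>t. t \<noteq> 0 \<Longrightarrow> c' t \<in> S"
    "\<And>t. t \<noteq> 0 \<Longrightarrow> dist (p + t *\<^sub>R v) (c' t) < infdist (p + t *\<^sub>R v) S + t\<^sup>2"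
    by metis
  define c where "c = (\<lambda>t. if t = 0 then p else c' t)"
  have "\<exists>d>0. \<forall>t. \<bar>t\<bar> < d \<longrightarrow> norm (c t - p - t *\<^sub>R v) \<le> e * \<bar>t\<bar>" if e: "e > 0" for e
  proof -
    define b where "b = 1 + norm v * norm w"
    have b: "b > 0" "norm v * norm w \<le> b"
      by (simp_all add: b_def add_pos_nonneg)
    have "e / (2 * b) > 0"
      using e b by simp
    moreover have "g p = 0"
      using p U(2) S by blast
    ultimately obtain d where d: "d > 0" "\<And>h. G h = 0 \<Longrightarrow> norm h < d \<Longrightarrow>
        \<exists>s. \<bar>s\<bar> \<le> e / (2 * b) * norm h \<and> p + h + s *\<^sub>R w \<in> U \<and> g (p + h + s *\<^sub>R w) = 0"
      using zero_set_near_kernel[OF U _ G w] by metis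
    show ?thesis
    proof (intro exI[of _ "min (e / 2) (d / (1 + norm v))"] conjI allI impI)
      show "min (e / 2) (d / (1 + norm v)) > 0"
        using e d(1) by (simp add: add_pos_nonneg)
      fix t assume "\<bar>t\<bar> < min (e / 2) (d / (1 + norm v))"
      then have t: "\<bar>t\<bar> < e / 2" "\<bar>t\<bar> * (1 + norm v) < d"
        by (simp_all add: field_simps add_pos_nonneg)
      show "norm (c t - p - t *\<^sub>R v) \<le> e * \<bar>t\<bar>"
      proof (cases "t = 0")
        case False
        have "G (t *\<^sub>R v) = 0"
          using v linear_scale[OF has_derivative_linear[OF G]] by simp
        moreover have "norm (t *\<^sub>R v) < d"
          using t(2) by (simp add: algebra_simps)
        ultimately obtain s where s: "\<bar>s\<bar> \<le> e / (2 * b) * norm (t *\<^sub>R v)"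
          "p + t *\<^sub>R v + s *\<^sub>R w \<in> U" "g (p + t *\<^sub>R v + s *\<^sub>R w) = 0"
          using d(2) by blast
        then have "p + t *\<^sub>R v + s *\<^sub>R w \<in> S"
          using S by blast
        then have "infdist (p + t *\<^sub>R v) S \<le> \<bar>s\<bar> * norm w"
          using infdist_le[of "p + t *\<^sub>R v + s *\<^sub>R w" S "p + t *\<^sub>R v"] by (simp add: dist_norm)
        also have "\<dots> \<le> e / (2 * b) * norm (t *\<^sub>R v) * norm w"
          using s(1) by (rule mult_right_mono) simp
        also have "\<dots> = e / (2 * b) * \<bar>t\<bar> * (norm v * norm w)"
          by simp
        also have "\<dots> \<le> e / (2 * b) * \<bar>t\<bar> * b"
          using e b by (intro mult_left_mono) auto
        also have "\<dots> = e / 2 * \<bar>t\<bar>"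
          using b by simp
        finally have "infdist (p + t *\<^sub>R v) S \<le> e / 2 * \<bar>t\<bar>" .
        moreover have "t\<^sup>2 \<le> e / 2 * \<bar>t\<bar>"
          using t(1) mult_right_mono[of "\<bar>t\<bar>" "e/2" "\<bar>t\<bar>"] by (simp add: power2_eq_square)
        ultimately have "dist (p + t *\<^sub>R v) (c' t) \<le> e * \<bar>t\<bar>"
          using c'(2)[OF False] by (simp add: field_simps)
        then show ?thesis
          using False by (simp add: c_def dist_norm norm_minus_commute diff_diff_eq)
      qed (simp add: c_def)
    qed
  qed
  then have "(c has_vector_derivative v) (at 0)"
    unfolding has_vector_derivative_def has_derivative_at_alt
    by (auto simp: c_def bounded_linear_scaleR_left)
  moreover have "\<forall>\<^sub>F t in at 0. c t \<in> S"
    using c'(1) p by (auto simp: c_def)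
  moreover have "c 0 = p"
    by (simp add: c_def)
  ultimately show ?thesis
    unfolding tangent_space_def by blast
qed

text \<open>
  Continuity and differentiability of \<open>u\<close> come out at once. The zero of \<open>g\<close> found on the vertical line
  over \<open>y\<close> lies on the graph, so it must be \<open>(y, u y)\<close>, and its distance to the tangent hyperplane is
  \<open>o(norm (y - x))\<close>.
\<close>
lemma has_derivative_of_graph_level_set:
  fixes u :: "real ^ 'n \<Rightarrow> real"
  assumes U: "open U" "(x, u x) \<in> U" "continuous_on U g"
    and S: "graph_of u \<inter> U = {q \<in> U. g q = 0}"
    and G: "(g has_derivative G) (at (x, u x))" and vert: "G (0, 1) \<noteq> 0"
  shows "(u has_derivative (\<lambda>v. - G (v, 0) / G (0, 1))) (at x)"
proof -
  interpret G: bounded_linear G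
    using G by (rule has_derivative_bounded_linear)
  define L where "L = (\<lambda>v. - G (v, 0) / G (0, 1))"
  have blL: "bounded_linear L"
    unfolding L_def
    by (intro bounded_linear_compose[OF bounded_linear_divide] bounded_linear_minus
        bounded_linear_compose[OF G.bounded_linear] bounded_linear_Pair
        bounded_linear_ident bounded_linear_zero)
  then obtain K where K: "K > 0" "\<And>v. \<bar>L v\<bar> \<le> norm v * K"
    using bounded_linear.pos_bounded by (metis real_norm_def)
  have kerL: "G (v, L v) = 0" for v
  proof -
    have "G (v, L v) = G (v, 0) + L v * G (0, 1)"
      using G.add[of "(v, 0)" "L v *\<^sub>R (0, 1)"] G.scaleR[of "L v" "(0, 1)"] by simp
    then show ?thesis
      using vert by (simp add: L_def)
  qed
  have "\<exists>d>0. \<forall>y. norm (y - x) < d \<longrightarrow> norm (u y - u x - L (y - x)) \<le> e * norm (y - x)"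
    if e: "e > 0" for e
  proof -
    have "(x, u x) \<in> graph_of u"
      by (simp add: graph_of_def)
    then have "g (x, u x) = 0"
      using S U(2) by blast
    moreover have "e / (1 + K) > 0"
      using e K by simp
    ultimately obtain d where d: "d > 0" "\<And>h. G h = 0 \<Longrightarrow> norm h < d \<Longrightarrow>
        \<exists>s. \<bar>s\<bar> \<le> e / (1 + K) * norm h \<and> (x, u x) + h + s *\<^sub>R (0, 1) \<in> U \<and>
            g ((x, u x) + h + s *\<^sub>R (0, 1)) = 0"
      using zero_set_near_kernel[OF U _ G vert] by metis
    show ?thesis
    proof (intro exI[of _ "d / (1 + K)"] conjI allI impI)
      show "d / (1 + K) > 0"
        using d K by simp
      fix y assume y: "norm (y - x) < d / (1 + K)"
      let ?h = "(y - x, L (y - x))"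
      have nh: "norm ?h \<le> (1 + K) * norm (y - x)"
        using norm_Pair_le[of "y - x" "L (y - x)"] K(2)[of "y - x"] by (simp add: algebra_simps)
      also have "\<dots> < d"
        using y K by (simp add: field_simps)
      finally obtain s where s: "\<bar>s\<bar> \<le> e / (1 + K) * norm ?h" "(x, u x) + ?h + s *\<^sub>R (0, 1) \<in> U"
          "g ((x, u x) + ?h + s *\<^sub>R (0, 1)) = 0"
        using d(2)[OF kerL] by blast
      then have "(x, u x) + ?h + s *\<^sub>R (0, 1) \<in> graph_of u"
        using S by blast
      then have "u y = u x + L (y - x) + s"
        by (simp add: graph_of_def)
      moreover have "\<bar>s\<bar> \<le> e / (1 + K) * ((1 + K) * norm (y - x))"
        using s(1) nh e K by (meson order_trans mult_left_mono divide_nonneg_nonneg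
            add_nonneg_nonneg less_imp_le zero_le_one)
      ultimately show "norm (u y - u x - L (y - x)) \<le> e * norm (y - x)"
        using K by simp
    qed
  qed
  then show ?thesis
    unfolding has_derivative_at_alt L_def[symmetric] using blL by blast
qed

definition gradient :: "(real ^ 'n \<Rightarrow> real) \<Rightarrow> real ^ 'n \<Rightarrow> real ^ 'n" where
  "gradient u x = (\<chi> i. frechet_derivative u (at x) (axis i 1))"

lemma has_derivative_gradient:
  fixes u :: "real ^ 'n \<Rightarrow> real"
  assumes "u differentiable (at x)"
  shows "(u has_derivative (\<lambda>v. gradient u x \<bullet> v)) (at x)"
proof -
  have D: "(u has_derivative frechet_derivative u (at x)) (at x)"
    using assms by (simp add: frechet_derivative_works)
  have "frechet_derivative u (at x) v = gradient u x \<bullet> v" for v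
  proof -
    have "frechet_derivative u (at x) v = frechet_derivative u (at x) (\<Sum>i\<in>UNIV. v $ i *\<^sub>R axis i 1)"
      by (simp add: basis_expansion flip: scalar_mult_eq_scaleR)
    also have "\<dots> = (\<Sum>i\<in>UNIV. v $ i * frechet_derivative u (at x) (axis i 1))"
      using has_derivative_linear[OF D] by (simp add: linear_sum linear_scale)
    finally show ?thesis
      by (simp add: gradient_def inner_vec_def mult.commute)
  qed
  then show ?thesis
    using D by (metis (no_types, lifting) ext)
qed

lemma tangent_space_graph:
  fixes u :: "real ^ 'n \<Rightarrow> real"
  assumes "u differentiable (at x)"
  shows "tangent_space (graph_of u) (x, u x) = {(v, gradient u x \<bullet> v) | v. True}"
proof (intro equalityI subsetI)
  note D = has_derivative_gradient[OF assms]
  fix X assume "X \<in> tangent_space (graph_of u) (x, u x)"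
  then obtain c where c: "c 0 = (x, u x)" "\<forall>\<^sub>F t in at 0. c t \<in> graph_of u"
      "(c has_vector_derivative X) (at 0)"
    unfolding tangent_space_def by blast
  have d: "(c has_derivative (\<lambda>t. t *\<^sub>R X)) (at 0)"
    using c(3) by (simp add: has_vector_derivative_def)
  have d1: "((\<lambda>t. fst (c t)) has_derivative (\<lambda>t. t *\<^sub>R fst X)) (at 0)"
    using has_derivative_fst[OF d] by simp
  have d2: "((\<lambda>t. snd (c t)) has_derivative (\<lambda>t. t *\<^sub>R snd X)) (at 0)"
    using has_derivative_snd[OF d] by simp
  have "((\<lambda>t. u (fst (c t))) has_derivative (\<lambda>t. gradient u x \<bullet> (t *\<^sub>R fst X))) (at 0)"
    by (rule has_derivative_compose[OF d1, of u]) (use D c(1) in simp)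
  then have "((\<lambda>t. snd (c t)) has_derivative (\<lambda>t. gradient u x \<bullet> (t *\<^sub>R fst X))) (at 0)"
  proof (rule has_derivative_transform_eventually)
    show "\<forall>\<^sub>F t in at 0. u (fst (c t)) = snd (c t)"
      using c(2) by eventually_elim (auto simp: graph_of_def)
  qed (simp_all add: c(1))
  then have "(\<lambda>t. gradient u x \<bullet> (t *\<^sub>R fst X)) = (\<lambda>t. t *\<^sub>R snd X)"
    using d2 has_derivative_unique by blast
  then have "gradient u x \<bullet> fst X = snd X"
    by (metis scaleR_one)
  then show "X \<in> {(v, gradient u x \<bullet> v) | v. True}"
    by (metis (mono_tags, lifting) mem_Collect_eq prod.collapse)
next
  note D = has_derivative_gradient[OF assms]
  fix X assume "X \<in> {(v, gradient u x \<bullet> v) | v. True}"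
  then obtain v where X: "X = (v, gradient u x \<bullet> v)"
    by blast
  let ?c = "\<lambda>t::real. (x + t *\<^sub>R v, u (x + t *\<^sub>R v))"
  have d1: "((\<lambda>t::real. x + t *\<^sub>R v) has_derivative (\<lambda>t. t *\<^sub>R v)) (at 0)"
    by (auto intro!: derivative_eq_intros)
  have "((\<lambda>t::real. u (x + t *\<^sub>R v)) has_derivative (\<lambda>t. gradient u x \<bullet> (t *\<^sub>R v))) (at 0)"
    by (rule has_derivative_compose[OF d1, of u]) (use D in simp)
  from has_derivative_Pair[OF d1 this] have "(?c has_vector_derivative X) (at 0)"
    by (simp add: has_vector_derivative_def X)
  moreover have "?c t \<in> graph_of u" for t
    by (simp add: graph_of_def)
  ultimately show "X \<in> tangent_space (graph_of u) (x, u x)"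
    unfolding tangent_space_def by (intro CollectI exI[of _ ?c]) simp
qed

text \<open>
  The time direction is timelike, hence not tangent, hence not in the kernel of the derivative of a
  local defining function. This is what makes \<open>u\<close> inherit the smoothness of the defining function.
\<close>
lemma spacelike_graph_level_set:
  fixes u :: "real ^ 'n \<Rightarrow> real"
  assumes "spacelike_hypersurface (graph_of u)"
  obtains U g where "open U" "(x, u x) \<in> U" "smooth_on U (g :: _ \<Rightarrow> real)"
    and "\<And>y. (y, u y) \<in> U \<Longrightarrow> frechet_derivative g (at (y, u y)) (0, 1) \<noteq> 0"
    and "\<And>y. (y, u y) \<in> U \<Longrightarrow> (u has_derivative (\<lambda>v. - frechet_derivative g (at (y, u y)) (v, 0)
            / frechet_derivative g (at (y, u y)) (0, 1))) (at y)"
proof -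
  have "(x, u x) \<in> graph_of u"
    by (simp add: graph_of_def)
  moreover have "smooth_hypersurface (graph_of u)"
    using assms by (simp add: spacelike_hypersurface_def)
  ultimately have "\<exists>U (g :: _ \<Rightarrow> real). open U \<and> (x, u x) \<in> U \<and> smooth_on U g \<and>
      (\<forall>q\<in>U. \<exists>v. frechet_derivative g (at q) v \<noteq> 0) \<and> graph_of u \<inter> U = {q \<in> U. g q = 0}"
    unfolding smooth_hypersurface_def by (rule bspec[rotated])
  then obtain U and g :: "(real ^ 'n) \<times> real \<Rightarrow> real" where U: "open U" "(x, u x) \<in> U"
      and g: "smooth_on U g" and reg: "\<forall>q\<in>U. \<exists>v. frechet_derivative g (at q) v \<noteq> 0"
      and S: "graph_of u \<inter> U = {q \<in> U. g q = 0}"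
    by (elim exE conjE)
  have "Ck_on 0 U g" "Ck_on (Suc 0) U g"
    using g unfolding smooth_on_def by blast+
  then have cont: "continuous_on U g"
    and G: "\<And>q. q \<in> U \<Longrightarrow> (g has_derivative frechet_derivative g (at q)) (at q)"
    by (simp_all add: frechet_derivative_works)
  have vert: "frechet_derivative g (at (y, u y)) (0, 1) \<noteq> 0" if y: "(y, u y) \<in> U" for y
  proof
    assume v: "frechet_derivative g (at (y, u y)) (0, 1) = 0"
    obtain w where w: "frechet_derivative g (at (y, u y)) w \<noteq> 0"
      using reg y by blast
    have gy: "(y, u y) \<in> graph_of u"
      by (simp add: graph_of_def)
    have "(0, 1) \<in> tangent_space (graph_of u) (y, u y)"
      by (rule kernel_subset_tangent_space[OF U(1) y cont S G[OF y] gy w v])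
    then have "minkowski (0, 1) (0 :: real ^ 'n, 1) > 0"
      using assms gy unfolding spacelike_hypersurface_def by (metis Pair_inject zero_neq_one zero_prod_def)
    then show False
      by (simp add: minkowski_def)
  qed
  show thesis
  proof (rule that[OF U g vert])
    fix y assume y: "(y, u y) \<in> U"
    show "(u has_derivative (\<lambda>v. - frechet_derivative g (at (y, u y)) (v, 0)
            / frechet_derivative g (at (y, u y)) (0, 1))) (at y)"
      by (rule has_derivative_of_graph_level_set[OF U(1) y cont S G[OF y] vert[OF y]])
  qed
qed

lemma spacelike_graph_differentiable:
  fixes u :: "real ^ 'n \<Rightarrow> real"
  assumes "spacelike_hypersurface (graph_of u)"
  shows "u differentiable (at x)"
  using spacelike_graph_level_set[OF assms, of x] by (metis differentiable_def)

lemma spacelike_graph_norm_gradient_less_1: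
  fixes u :: "real ^ 'n \<Rightarrow> real"
  assumes "spacelike_hypersurface (graph_of u)"
  shows "norm (gradient u x) < 1"
proof (rule ccontr)
  let ?a = "gradient u x"
  assume "\<not> norm ?a < 1"
  then have a: "norm ?a \<ge> 1"
    by simp
  then have "?a \<noteq> 0"
    by force
  moreover have "(?a, ?a \<bullet> ?a) \<in> tangent_space (graph_of u) (x, u x)"
    using tangent_space_graph[OF spacelike_graph_differentiable[OF assms]] by blast
  moreover have "(x, u x) \<in> graph_of u"
    by (simp add: graph_of_def)
  ultimately have "minkowski (?a, ?a \<bullet> ?a) (?a, ?a \<bullet> ?a) > 0"
    using assms unfolding spacelike_hypersurface_def by (metis fst_conv fst_zero)
  then have "?a \<bullet> ?a * 1 > (?a \<bullet> ?a) * (?a \<bullet> ?a)"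
    by (simp add: minkowski_def)
  then have "?a \<bullet> ?a < 1"
    by (metis inner_ge_zero mult_less_cancel_left_disj not_less)
  then show False
    using a by (simp add: norm_eq_sqrt_inner)
qed

text \<open>
  Implicit differentiation expresses the gradient of \<open>u\<close> by first derivatives of \<open>g\<close> along the
  graph, and these are differentiable because \<open>g\<close> is smooth.
\<close>
lemma spacelike_graph_gradient_differentiable:
  fixes u :: "real ^ 'n \<Rightarrow> real"
  assumes "spacelike_hypersurface (graph_of u)"
  shows "gradient u differentiable (at x)"
proof -
  note du = spacelike_graph_differentiable[OF assms]
  obtain U g where U: "open U" "(x, u x) \<in> U" and g: "smooth_on U (g :: _ \<Rightarrow> real)"
    and vert: "\<And>y. (y, u y) \<in> U \<Longrightarrow> frechet_derivative g (at (y, u y)) (0, 1) \<noteq> 0"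
    and D: "\<And>y. (y, u y) \<in> U \<Longrightarrow> (u has_derivative (\<lambda>v. - frechet_derivative g (at (y, u y)) (v, 0)
            / frechet_derivative g (at (y, u y)) (0, 1))) (at y)"
    using spacelike_graph_level_set[OF assms, of x] by blast
  let ?\<gamma> = "\<lambda>y. (y, u y)"
  have \<gamma>: "?\<gamma> differentiable (at x)"
    using has_derivative_Pair[OF has_derivative_ident has_derivative_gradient[OF du]]
    by (auto simp: differentiable_def)
  then have "isCont ?\<gamma> x"
    by (simp add: differentiable_imp_continuous_within)
  then have ev: "\<forall>\<^sub>F y in at x. ?\<gamma> y \<in> U"
    using U by (simp add: continuous_within topological_tendstoD)
  have "Ck_on (Suc (Suc 0)) U g"
    using g unfolding smooth_on_def by blast
  then have "(\<lambda>q. frechet_derivative g (at q) v) differentiable (at (?\<gamma> x))" for v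
    using U(2) by (cases v) simp
  then have g2: "(\<lambda>y. frechet_derivative g (at (?\<gamma> y)) v) differentiable (at x)" for v
    by (rule differentiable_chain_at[OF \<gamma>, unfolded o_def])
  have "(\<lambda>y. gradient u y \<bullet> b) differentiable (at x)" for b
  proof -
    have eq: "- frechet_derivative g (at (?\<gamma> y)) (b, 0) / frechet_derivative g (at (?\<gamma> y)) (0, 1)
        = gradient u y \<bullet> b" if "?\<gamma> y \<in> U" for y
      using has_derivative_unique[OF D[OF that] has_derivative_gradient[OF du]] by metis
    have "(\<lambda>y. - frechet_derivative g (at (?\<gamma> y)) (b, 0) / frechet_derivative g (at (?\<gamma> y)) (0, 1))
        differentiable (at x)"
      using g2 vert[OF U(2)] by (intro differentiable_divide differentiable_minus)
    then obtain F where F: "((\<lambda>y. - frechet_derivative g (at (?\<gamma> y)) (b, 0) /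
        frechet_derivative g (at (?\<gamma> y)) (0, 1)) has_derivative F) (at x)"
      by (auto simp: differentiable_def)
    have "((\<lambda>y. gradient u y \<bullet> b) has_derivative F) (at x)"
      by (rule has_derivative_transform_eventually[OF F])
        (use ev eq U(2) in \<open>auto elim!: eventually_mono\<close>)
    then show ?thesis
      by (auto simp: differentiable_def)
  qed
  then show ?thesis
    by (subst differentiable_componentwise_within) blast
qed

section \<open>Mean curvature of a graph\<close>

text \<open>
  Basis independence of the trace, for a frame \<open>c\<close> with coordinate functionals \<open>\<phi>\<close>: expand the
  vectors of the chosen basis in the frame, and then the frame in the basis.
\<close>
lemma trace_on_eq_sum_coordinates:
  fixes A :: "'a::euclidean_space \<Rightarrow> 'a" and c :: "'i::finite \<Rightarrow> 'a"
  assumes A: "linear A" and AV: "\<And>x. x \<in> V \<Longrightarrow> A x \<in> V"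
    and c: "\<And>i. c i \<in> V" and \<phi>: "\<And>i. linear (\<phi> i)"
    and decomp: "\<And>x. x \<in> V \<Longrightarrow> (\<Sum>i\<in>UNIV. \<phi> i x *\<^sub>R c i) = x"
  shows "trace_on V A = (\<Sum>i\<in>UNIV. \<phi> i (A (c i)))"
proof -
  define B where "B = (SOME B. B \<subseteq> V \<and> independent B \<and> V \<subseteq> span B)"
  have "\<exists>B. B \<subseteq> V \<and> independent B \<and> V \<subseteq> span B"
    by (rule maximal_independent_subset[of V]) blast
  then have "B \<subseteq> V \<and> independent B \<and> V \<subseteq> span B"
    unfolding B_def by (rule someI_ex)
  then have B: "B \<subseteq> V" "independent B" "V \<subseteq> span B"
    by auto
  have fin: "finite B"
    using B(2) by (rule independent_imp_finite)
  have cB: "c i \<in> span B" for i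
    using B(3) c by (rule subsetD)
  have rep: "representation B (A b) b = (\<Sum>i\<in>UNIV. \<phi> i (A b) * representation B (c i) b)" if "b \<in> B" for b
  proof -
    have "A b \<in> V"
      using that B(1) AV by blast
    then have "representation B (A b) b = representation B (\<Sum>i\<in>UNIV. \<phi> i (A b) *\<^sub>R c i) b"
      by (simp add: decomp)
    also have "\<dots> = (\<Sum>i\<in>UNIV. representation B (\<phi> i (A b) *\<^sub>R c i) b)"
      by (simp add: real_vector.representation_sum[OF B(2) span_scale[OF cB]])
    also have "\<dots> = (\<Sum>i\<in>UNIV. \<phi> i (A b) * representation B (c i) b)"
      by (simp add: real_vector.representation_scale[OF B(2) cB])
    finally show ?thesis .
  qed
  have "trace_on V A = (\<Sum>b\<in>B. representation B (A b) b)"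
    by (simp add: trace_on_def B_def Let_def)
  also have "\<dots> = (\<Sum>b\<in>B. \<Sum>i\<in>UNIV. \<phi> i (A b) * representation B (c i) b)"
    using rep by simp
  also have "\<dots> = (\<Sum>i\<in>UNIV. \<Sum>b\<in>B. \<phi> i (A b) * representation B (c i) b)"
    by (rule sum.swap)
  also have "\<dots> = (\<Sum>i\<in>UNIV. \<phi> i (A (\<Sum>b\<in>B. representation B (c i) b *\<^sub>R b)))"
    by (simp add: linear_sum[OF A] linear_scale[OF A] linear_sum[OF \<phi>] linear_scale[OF \<phi>] mult.commute)
  also have "\<dots> = (\<Sum>i\<in>UNIV. \<phi> i (A (c i)))"
    by (simp add: real_vector.sum_representation_eq[OF B(2) cB fin order_refl])
  finally show ?thesis .
qed

lemma unit_normal_graph: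
  fixes u :: "real ^ 'n \<Rightarrow> real"
  assumes "u differentiable (at x)" and less: "norm (gradient u x) < 1"
  defines "l \<equiv> 1 / sqrt (1 - (norm (gradient u x))\<^sup>2)"
  shows "unit_normal (graph_of u) (x, u x) = (l *\<^sub>R gradient u x, l)"
proof -
  let ?a = "gradient u x"
  have pos: "1 - (norm ?a)\<^sup>2 > 0"
    using less by (simp add: power_less_one_iff abs_square_less_1)
  then have l: "l > 0" "l\<^sup>2 * (1 - (norm ?a)\<^sup>2) = 1"
    by (simp_all add: l_def power_divide)
  show ?thesis
    unfolding unit_normal_def tangent_space_graph[OF assms(1)]
  proof (rule the_equality)
    show "(\<forall>v\<in>{(v, ?a \<bullet> v) |v. True}. minkowski (l *\<^sub>R ?a, l) v = 0) \<and>
      minkowski (l *\<^sub>R ?a, l) (l *\<^sub>R ?a, l) = - 1 \<and> snd (l *\<^sub>R ?a, l) > 0"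
      using l by (auto simp: minkowski_def power2_norm_eq_inner algebra_simps) (simp add: power2_eq_square)
    fix \<nu> :: "(real ^ 'n) \<times> real"
    assume *: "(\<forall>v\<in>{(v, ?a \<bullet> v) |v. True}. minkowski \<nu> v = 0) \<and> minkowski \<nu> \<nu> = - 1 \<and> snd \<nu> > 0"
    note orth = conjunct1[OF *]
      and \<nu> = conjunct1[OF conjunct2[OF *]] conjunct2[OF conjunct2[OF *]]
    have "(fst \<nu> - snd \<nu> *\<^sub>R ?a) \<bullet> v = 0" for v
      using bspec[OF orth, of "(v, ?a \<bullet> v)"] by (simp add: minkowski_def inner_diff_left)
    from this[of "fst \<nu> - snd \<nu> *\<^sub>R ?a"] have f: "fst \<nu> = snd \<nu> *\<^sub>R ?a"
      by simp
    then have "(snd \<nu>)\<^sup>2 * (1 - (norm ?a)\<^sup>2) = 1"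
      using \<nu> by (simp add: minkowski_def power2_norm_eq_inner algebra_simps) (simp add: power2_eq_square)
    then have "(snd \<nu>)\<^sup>2 = l\<^sup>2"
      using l(2) pos mult_right_cancel[of "1 - (norm ?a)\<^sup>2" "(snd \<nu>)\<^sup>2" "l\<^sup>2"] by linarith
    then have "snd \<nu> = l"
      by (rule power2_eq_imp_eq) (use \<nu> l(1) in simp_all)
    then show "\<nu> = (l *\<^sub>R ?a, l)"
      using f by (simp add: prod_eq_iff)
  qed
qed

lemma has_derivative_lorentz_factor:
  fixes a :: "'a::real_normed_vector \<Rightarrow> 'b::real_inner"
  assumes D: "(a has_derivative D) (at x)" and less: "norm (a x) < 1"
  shows "((\<lambda>y. 1 / sqrt (1 - (norm (a y))\<^sup>2)) has_derivative
           (\<lambda>v. (1 / sqrt (1 - (norm (a x))\<^sup>2)) ^ 3 * (a x \<bullet> D v))) (at x)"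
proof -
  have "1 - (norm (a x))\<^sup>2 > 0"
    using less by (simp add: power_less_one_iff abs_square_less_1)
  then have pos: "1 - a x \<bullet> a x > 0"
    by (simp add: power2_norm_eq_inner)
  define s where "s = sqrt (1 - a x \<bullet> a x)"
  have s: "s > 0"
    using pos by (simp add: s_def)
  have 1: "((\<lambda>y. 1 - a y \<bullet> a y) has_derivative (\<lambda>v. - 2 * (a x \<bullet> D v))) (at x)"
    by (rule derivative_eq_intros D refl)+ (simp add: inner_commute)
  have "((\<lambda>y. sqrt (1 - a y \<bullet> a y)) has_derivative (\<lambda>v. (- 2 * (a x \<bullet> D v)) * (inverse s / 2))) (at x)"
    unfolding s_def
    by (rule has_derivative_eq_rhs[OF DERIV_compose_FDERIV[OF DERIV_real_sqrt[OF pos] 1]]) auto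
  then have "((\<lambda>y. inverse (sqrt (1 - a y \<bullet> a y))) has_derivative
      (\<lambda>v. - (inverse s * ((- 2 * (a x \<bullet> D v)) * (inverse s / 2)) * inverse s))) (at x)"
    using s unfolding s_def by (intro Deriv.has_derivative_inverse) auto
  moreover have "(\<lambda>v. - (inverse s * ((- 2 * (a x \<bullet> D v)) * (inverse s / 2)) * inverse s)) =
      (\<lambda>v. (1 / s) ^ 3 * (a x \<bullet> D v))"
    using s by (simp add: field_simps power3_eq_cube)
  ultimately show ?thesis
    unfolding power2_norm_eq_inner s_def[symmetric] inverse_eq_divide
    by (rule has_derivative_eq_rhs)
qed

text \<open>
  The nonparametric form of the mean curvature. With \<open>a\<close> the gradient and \<open>D\<close> the Hessian,
  the right-hand side is the divergence of \<open>l *\<^sub>R a\<close>, the horizontal part of the unit normal, because the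
  trace over the tangent space can be taken in the frame of the vectors \<open>(e\<^sub>i, a \<bullet> e\<^sub>i)\<close>, whose coordinates
  are the horizontal ones. In this form the mean curvature is visibly monotone in the quadratic form
  \<open>\<lambda>v. v \<bullet> D v\<close> once the gradient is fixed, which is all that a comparison argument needs.
\<close>
lemma mean_curvature_graph:
  fixes u :: "real ^ 'n \<Rightarrow> real"
  assumes du: "\<And>y. u differentiable (at y)" and less: "\<And>y. norm (gradient u y) < 1"
    and D: "(gradient u has_derivative D) (at x)"
  defines "l \<equiv> 1 / sqrt (1 - (norm (gradient u x))\<^sup>2)"
  shows "real CARD('n) * mean_curvature (graph_of u) (x, u x) =
         l * ((\<Sum>i\<in>UNIV. D (axis i 1) $ i) + l\<^sup>2 * (gradient u x \<bullet> D (gradient u x)))"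
proof -
  let ?a = "gradient u x" and ?S = "graph_of u" and ?p = "(x, u x)"
  let ?e = "\<lambda>i. axis i 1 :: real ^ 'n"
  define A where "A = frechet_derivative (unit_normal ?S) (at ?p within ?S)"
  define V where "V = {(v, ?a \<bullet> v) | v. True}"
  define N where "N = (\<lambda>y. ((1 / sqrt (1 - (norm (gradient u y))\<^sup>2)) *\<^sub>R gradient u y,
      1 / sqrt (1 - (norm (gradient u y))\<^sup>2)))"
  define N' where "N' = (\<lambda>v. (l *\<^sub>R D v + (l ^ 3 * (?a \<bullet> D v)) *\<^sub>R ?a, l ^ 3 * (?a \<bullet> D v)))"
  have linD: "linear D"
    using D by (rule has_derivative_linear)
  have "1 - (norm ?a)\<^sup>2 > 0"
    using less by (simp add: power_less_one_iff abs_square_less_1)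
  then have l: "l > 0" "l\<^sup>2 * (1 - (norm ?a)\<^sup>2) = 1"
    by (simp_all add: l_def power_divide)
  have normal: "unit_normal ?S (y, u y) = N y" for y
    using unit_normal_graph[OF du less] by (simp add: N_def)
  have dN: "(N has_derivative N') (at x)"
    unfolding N_def N'_def l_def
    by (rule has_derivative_Pair has_derivative_scaleR has_derivative_lorentz_factor D less)+
  have "((\<lambda>q. N (fst q)) has_derivative (\<lambda>X. N' (fst X))) (at ?p within ?S)"
    by (rule has_derivative_compose[OF has_derivative_fst[OF has_derivative_ident], of N N'])
      (use dN in simp)
  then have "(unit_normal ?S has_derivative (\<lambda>X. N' (fst X))) (at ?p within ?S)"
  proof (rule has_derivative_transform[rotated 2])
    show "unit_normal ?S q = N (fst q)" if "q \<in> ?S" for q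
    proof -
      obtain y where "q = (y, u y)"
        using \<open>q \<in> ?S\<close> by (auto simp: graph_of_def)
      then show ?thesis
        by (simp add: normal)
    qed
  qed (simp add: graph_of_def)
  then have A: "(unit_normal ?S has_derivative A) (at ?p within ?S)"
    unfolding A_def by (metis differentiable_def frechet_derivative_works)
  \<comment> \<open>The derivative within the graph is not unique as a map on the ambient space, but composition
    with the parametrization determines it on tangent vectors.\<close>
  have AN: "A (v, ?a \<bullet> v) = N' v" for v
  proof -
    have \<gamma>: "((\<lambda>y. (y, u y)) has_derivative (\<lambda>v. (v, ?a \<bullet> v))) (at x)"
      by (rule has_derivative_Pair[OF has_derivative_ident has_derivative_gradient[OF du]])
    have "(unit_normal ?S has_derivative A) (at ?p within range (\<lambda>y. (y, u y)))"
      using A by (rule has_derivative_subset) (auto simp: graph_of_def)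
    then have "((\<lambda>y. unit_normal ?S (y, u y)) has_derivative (\<lambda>v. A (v, ?a \<bullet> v))) (at x)"
      by (rule has_derivative_in_compose[OF \<gamma>])
    then have "(N has_derivative (\<lambda>v. A (v, ?a \<bullet> v))) (at x)"
      by (simp add: normal)
    then show ?thesis
      using has_derivative_unique[OF dN] by metis
  qed
  have "A X \<in> V" if X: "X \<in> V" for X
  proof -
    obtain v where "X = (v, ?a \<bullet> v)"
      using X unfolding V_def by auto
    moreover have "?a \<bullet> (l *\<^sub>R D v + (l ^ 3 * (?a \<bullet> D v)) *\<^sub>R ?a) = l ^ 3 * (?a \<bullet> D v)"
    proof -
      \<comment> \<open>The identity \<open>l\<^sup>2 * (1 - norm a\<^sup>2) = 1\<close> says that the normal has constant length, so that its
        derivative is tangent.\<close>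
      have "l = l * (l\<^sup>2 * (1 - ?a \<bullet> ?a))"
        using l(2) by (simp add: power2_norm_eq_inner)
      also have "\<dots> = l ^ 3 * (1 - ?a \<bullet> ?a)"
        by (simp add: power2_eq_square power3_eq_cube)
      finally have *: "l = l ^ 3 * (1 - ?a \<bullet> ?a)" .
      have "?a \<bullet> (l *\<^sub>R D v + (l ^ 3 * (?a \<bullet> D v)) *\<^sub>R ?a) =
          l * (?a \<bullet> D v) + l ^ 3 * (?a \<bullet> D v) * (?a \<bullet> ?a)"
        by (simp add: inner_add_right)
      also have "\<dots> = l ^ 3 * (1 - ?a \<bullet> ?a) * (?a \<bullet> D v) + l ^ 3 * (?a \<bullet> D v) * (?a \<bullet> ?a)"
        using * by simp
      finally show ?thesis
        by (simp add: algebra_simps)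
    qed
    ultimately show ?thesis
      unfolding V_def by (auto simp: AN N'_def)
  qed
  moreover have "(\<Sum>i\<in>UNIV. fst X $ i *\<^sub>R (?e i, ?a \<bullet> ?e i)) = X" if X: "X \<in> V" for X
  proof -
    obtain v where v: "X = (v, ?a \<bullet> v)"
      using X unfolding V_def by auto
    have "(\<Sum>i\<in>UNIV. v $ i *\<^sub>R ?e i) = v"
      by (simp add: basis_expansion flip: scalar_mult_eq_scaleR)
    moreover have "(\<Sum>i\<in>UNIV. v $ i *\<^sub>R (?a \<bullet> ?e i)) = ?a \<bullet> v"
      by (simp add: inner_axis) (simp add: inner_vec_def mult.commute)
    ultimately show ?thesis
      by (simp add: v prod_eq_iff fst_sum snd_sum)
  qed
  moreover have "linear (\<lambda>X :: (real ^ 'n) \<times> real. fst X $ i)" for i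
    by (intro linearI) simp_all
  ultimately have "trace_on V A = (\<Sum>i\<in>UNIV. fst (A (?e i, ?a \<bullet> ?e i)) $ i)"
    using has_derivative_linear[OF A]
    by (intro trace_on_eq_sum_coordinates[where \<phi> = "\<lambda>i X. fst X $ i" and c = "\<lambda>i. (?e i, ?a \<bullet> ?e i)"])
      (auto simp: V_def)
  also have "\<dots> = l * (\<Sum>i\<in>UNIV. D (?e i) $ i) + l ^ 3 * (\<Sum>i\<in>UNIV. ?a $ i * (?a \<bullet> D (?e i)))"
    by (simp add: AN N'_def sum.distrib sum_distrib_left mult_ac)
  also have "(\<Sum>i\<in>UNIV. ?a $ i * (?a \<bullet> D (?e i))) = ?a \<bullet> D (\<Sum>i\<in>UNIV. ?a $ i *\<^sub>R ?e i)"
    using linD by (simp add: linear_sum linear_scale inner_sum_right)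
  also have "(\<Sum>i\<in>UNIV. ?a $ i *\<^sub>R ?e i) = ?a"
    by (simp add: basis_expansion flip: scalar_mult_eq_scaleR)
  finally have "trace_on V A = l * ((\<Sum>i\<in>UNIV. D (?e i) $ i) + l\<^sup>2 * (?a \<bullet> D ?a))"
    by (simp add: power2_eq_square power3_eq_cube algebra_simps)
  moreover have "mean_curvature ?S ?p = trace_on V A / real CARD('n)"
    unfolding mean_curvature_def tangent_space_graph[OF du] A_def V_def ..
  ultimately show ?thesis
    by simp
qed

section \<open>Second-order test at a maximum\<close>

text \<open>
  The second derivative test at a global maximum, by restriction to lines; \<open>D\<close> is the Hessian,
  as the derivative of the gradient \<open>F\<close>.
\<close>
lemma max_gradient_hessian:
  fixes f :: "'a::real_inner \<Rightarrow> real"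
  assumes f: "\<And>y. (f has_derivative (\<lambda>v. F y \<bullet> v)) (at y)" and F: "(F has_derivative D) (at x)"
    and max: "\<And>y. f y \<le> f x"
  shows "F x = 0" "v \<bullet> D v \<le> 0"
proof -
  have line: "((\<lambda>t. f (x + t *\<^sub>R v)) has_real_derivative F (x + t *\<^sub>R v) \<bullet> v) (at t)" for v t
  proof -
    have "((\<lambda>t. x + t *\<^sub>R v) has_derivative (\<lambda>t. t *\<^sub>R v)) (at t)"
      by (auto intro!: derivative_eq_intros)
    from has_derivative_compose[OF this f] show ?thesis
      by (simp add: has_field_derivative_def mult_commute_abs)
  qed
  have crit: "F x \<bullet> v = 0" for v
    using DERIV_local_max[OF line[of v 0], of 1] max by simp
  from crit[of "F x"] show "F x = 0"
    by simp
  show "v \<bullet> D v \<le> 0"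
  proof (rule ccontr)
    assume "\<not> v \<bullet> D v \<le> 0"
    moreover have "((\<lambda>t. F (x + t *\<^sub>R v) \<bullet> v) has_real_derivative D v \<bullet> v) (at 0)"
    proof -
      have "((\<lambda>t. x + t *\<^sub>R v) has_derivative (\<lambda>t. t *\<^sub>R v)) (at 0)"
        by (auto intro!: derivative_eq_intros)
      then have "((\<lambda>t. F (x + t *\<^sub>R v)) has_derivative (\<lambda>t. D (t *\<^sub>R v))) (at 0)"
        by (rule has_derivative_compose) (use F in simp)
      then have "((\<lambda>t. F (x + t *\<^sub>R v) \<bullet> v) has_derivative (\<lambda>t. D (t *\<^sub>R v) \<bullet> v)) (at 0)"
        by (rule has_derivative_inner_left)
      then show ?thesis
        using linear_scale[OF has_derivative_linear[OF F]]
        by (simp add: has_field_derivative_def mult_commute_abs)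
    qed
    ultimately obtain d where d: "d > 0" "\<And>t. 0 < t \<Longrightarrow> t < d \<Longrightarrow> F (x + t *\<^sub>R v) \<bullet> v > 0"
      using DERIV_pos_inc_right[of "\<lambda>t. F (x + t *\<^sub>R v) \<bullet> v" "D v \<bullet> v" 0] crit
      by (auto simp: inner_commute)
    have "f (x + 0 *\<^sub>R v) < f (x + (d/2) *\<^sub>R v)"
    proof (rule DERIV_pos_imp_increasing_open[where f = "\<lambda>t. f (x + t *\<^sub>R v)"])
      show "0 < d / 2"
        using d(1) by simp
      show "\<exists>y. ((\<lambda>t. f (x + t *\<^sub>R v)) has_real_derivative y) (at t) \<and> 0 < y" if "0 < t" "t < d/2" for t
        using line d(2)[of t] that by auto
      show "continuous_on {0..d/2} (\<lambda>t. f (x + t *\<^sub>R v))"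
        using line by (meson DERIV_isCont continuous_at_imp_continuous_on)
    qed
    then show False
      using max[of "x + (d/2) *\<^sub>R v"] by simp
  qed
qed

section \<open>Null support function and asymptotic offsets\<close>

lemma gradient_less_1_imp_lipschitz:
  fixes u :: "real ^ 'n \<Rightarrow> real"
  assumes du: "\<And>y. u differentiable (at y)" and less: "\<And>y. norm (gradient u y) < 1"
  shows "u x \<le> u y + norm (x - y)"
proof -
  have "norm (u x - u y) \<le> 1 * norm (x - y)"
  proof (rule differentiable_bound)
    show "(u has_derivative (\<lambda>v. gradient u z \<bullet> v)) (at z within UNIV)" for z
      using has_derivative_gradient[OF du] by simp
    show "onorm (\<lambda>v. gradient u z \<bullet> v) \<le> 1" for z
    proof (rule onorm_le)
      fix v
      have "norm (gradient u z \<bullet> v) \<le> norm (gradient u z) * norm v"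
        using Cauchy_Schwarz_ineq2 by simp
      also have "\<dots> \<le> 1 * norm v"
        using less[of z] by (intro mult_right_mono) auto
      finally show "norm (gradient u z \<bullet> v) \<le> 1 * norm v" .
    qed
  qed auto
  then show ?thesis
    by simp
qed

text \<open>
  The inequality \<open>2 * N * r \<le> N\<^sup>2 + r\<^sup>2\<close> for the norm \<open>N\<close> on the left. It says that the light cone with
  vertex \<open>- z\<close> is asymptotic, along the ray of \<open>\<theta>\<close>, to a null hyperplane, with an error that is uniform in \<open>\<theta>\<close>.
\<close>
lemma norm_scaleR_add_le:
  fixes \<theta> z :: "'a::real_inner"
  assumes "norm \<theta> = 1" "r > 0"
  shows "norm (r *\<^sub>R \<theta> + z) \<le> r + \<theta> \<bullet> z + (norm z)\<^sup>2 / (2 * r)"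
proof -
  let ?N = "norm (r *\<^sub>R \<theta> + z)"
  have "\<theta> \<bullet> \<theta> = 1"
    using assms(1) by (simp add: norm_eq_1)
  then have "?N\<^sup>2 = r\<^sup>2 + 2 * r * (\<theta> \<bullet> z) + (norm z)\<^sup>2"
    unfolding power2_norm_eq_inner
    by (simp add: inner_add_left inner_add_right inner_commute power2_eq_square algebra_simps)
  moreover have "0 \<le> (?N - r)\<^sup>2"
    by simp
  ultimately have "2 * r * ?N \<le> 2 * r * (r + \<theta> \<bullet> z) + (norm z)\<^sup>2"
    by (simp add: power2_eq_square algebra_simps)
  then show ?thesis
    using assms(2) by (simp add: field_simps)
qed

text \<open>
  Since \<open>u\<close> is 1-Lipschitz, its graph lies below the light cone with vertex \<open>(y, u y)\<close>, and this cone
  approaches the null hyperplane of height \<open>u y - \<theta> \<bullet> y\<close> along the ray of \<open>\<theta>\<close>. So the offset along the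
  ray is in the limit at least \<open>\<theta> \<bullet> y - u y\<close>, for every \<open>y\<close>; the points of the ray show that it is at
  most the supremum.
\<close>
lemma tendsto_null_support:
  fixes u :: "real ^ 'n \<Rightarrow> real"
  assumes lip: "\<And>x y. u x \<le> u y + norm (x - y)" and \<theta>: "norm \<theta> = 1"
  shows "((\<lambda>r. ereal (r - u (r *\<^sub>R \<theta>))) \<longlongrightarrow> null_support u \<theta>) at_top"
proof (rule order_tendstoI)
  fix c assume "c < null_support u \<theta>"
  then obtain y where y: "c < ereal (\<theta> \<bullet> y - u y)"
    unfolding null_support_def less_SUP_iff by auto
  have "((\<lambda>r. \<theta> \<bullet> y - u y - (norm y)\<^sup>2 / (2 * r)) \<longlongrightarrow> \<theta> \<bullet> y - u y - 0) at_top"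
    by (intro tendsto_intros tendsto_divide_0 filterlim_at_top_imp_at_infinity
        filterlim_tendsto_pos_mult_at_top[OF tendsto_const] filterlim_ident) auto
  then have "((\<lambda>r. ereal (\<theta> \<bullet> y - u y - (norm y)\<^sup>2 / (2 * r))) \<longlongrightarrow> ereal (\<theta> \<bullet> y - u y)) at_top"
    by simp
  then have "\<forall>\<^sub>F r in at_top. c < ereal (\<theta> \<bullet> y - u y - (norm y)\<^sup>2 / (2 * r))"
    using y by (rule order_tendstoD)
  then show "\<forall>\<^sub>F r in at_top. c < ereal (r - u (r *\<^sub>R \<theta>))"
    using eventually_gt_at_top[of 0]
  proof eventually_elim
    case (elim r)
    have "norm (r *\<^sub>R \<theta> - y) \<le> r - \<theta> \<bullet> y + (norm y)\<^sup>2 / (2 * r)"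
      using norm_scaleR_add_le[OF \<theta> elim(2), of "- y"] by simp
    then have "\<theta> \<bullet> y - u y - (norm y)\<^sup>2 / (2 * r) \<le> r - u (r *\<^sub>R \<theta>)"
      using lip[of "r *\<^sub>R \<theta>" y] by simp
    then show ?case
      using elim(1) by (meson ereal_less_eq(3) less_le_trans)
  qed
next
  fix c assume c: "null_support u \<theta> < c"
  have "ereal (r - u (r *\<^sub>R \<theta>)) \<le> null_support u \<theta>" for r
  proof -
    have "\<theta> \<bullet> (r *\<^sub>R \<theta>) = r"
      using \<theta> by (simp add: norm_eq_1)
    then show ?thesis
      unfolding null_support_def by (intro SUP_upper2[of "r *\<^sub>R \<theta>"]) auto
  qed
  then show "\<forall>\<^sub>F r in at_top. ereal (r - u (r *\<^sub>R \<theta>)) < c"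
    using c le_less_trans by (intro always_eventually) blast
qed

lemma null_support_gt_minus_infinity: "null_support u \<theta> > - \<infinity>"
proof -
  have "ereal (\<theta> \<bullet> 0 - u 0) \<le> null_support u \<theta>"
    unfolding null_support_def by (rule SUP_upper) simp
  then show ?thesis
    by (metis MInfty_neq_ereal(1) ereal_infty_less_eq(2) ereal_infty_less(2))
qed

lemma null_support_finite_imp_lightlike:
  fixes u :: "real ^ 'n \<Rightarrow> real"
  assumes lip: "\<And>x y. u x \<le> u y + norm (x - y)" and \<theta>: "norm \<theta> = 1"
    and fin: "null_support u \<theta> < \<infinity>"
  shows "\<theta> \<in> lightlike_directions u"
proof -
  obtain c where "null_support u \<theta> = ereal c"
    using fin null_support_gt_minus_infinity[of u \<theta>] by (cases "null_support u \<theta>") auto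
  then have "((\<lambda>r. r - u (r *\<^sub>R \<theta>)) \<longlongrightarrow> c) at_top"
    using tendsto_null_support[OF lip \<theta>] by simp
  then have "((\<lambda>r. (r - u (r *\<^sub>R \<theta>)) / r) \<longlongrightarrow> 0) at_top"
    by (rule tendsto_divide_0) (rule filterlim_at_top_imp_at_infinity[OF filterlim_ident])
  then have "((\<lambda>r. 1 - (r - u (r *\<^sub>R \<theta>)) / r) \<longlongrightarrow> 1 - 0) at_top"
    by (intro tendsto_intros)
  then have "((\<lambda>r. u (r *\<^sub>R \<theta>) / r) \<longlongrightarrow> 1 - 0) at_top"
  proof (rule Lim_transform_eventually)
    show "\<forall>\<^sub>F r in at_top. 1 - (r - u (r *\<^sub>R \<theta>)) / r = u (r *\<^sub>R \<theta>) / r"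
      using eventually_gt_at_top[of 0] by eventually_elim (simp add: field_simps)
  qed
  then show ?thesis
    using \<theta> by (simp add: lightlike_directions_def)
qed

text \<open>
  The functions \<open>\<lambda>\<theta>. u (r *\<^sub>R \<theta>) / r\<close> are 1-Lipschitz uniformly in \<open>r\<close>.
\<close>
lemma closed_lightlike_directions:
  fixes u :: "real ^ 'n \<Rightarrow> real"
  assumes lip: "\<And>x y. u x \<le> u y + norm (x - y)"
  shows "closed (lightlike_directions u)"
proof -
  have "\<theta> \<in> lightlike_directions u" if \<theta>: "\<theta> \<in> closure (lightlike_directions u)" for \<theta>
  proof -
    have "lightlike_directions u \<subseteq> sphere 0 1"
      by (auto simp: lightlike_directions_def)
    then have "\<theta> \<in> sphere 0 1"
      using \<theta> closure_minimal[OF _ closed_sphere] by blast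
    moreover have "((\<lambda>r. u (r *\<^sub>R \<theta>) / r) \<longlongrightarrow> 1) at_top"
    proof (rule tendstoI)
      fix e :: real assume e: "e > 0"
      then obtain \<eta> where \<eta>: "\<eta> \<in> lightlike_directions u" "dist \<eta> \<theta> < e / 2"
        using \<theta> unfolding closure_approachable by (meson half_gt_zero)
      then have "((\<lambda>r. u (r *\<^sub>R \<eta>) / r) \<longlongrightarrow> 1) at_top"
        by (simp add: lightlike_directions_def)
      then have "\<forall>\<^sub>F r in at_top. dist (u (r *\<^sub>R \<eta>) / r) 1 < e / 2"
        using e by (intro tendstoD) auto
      then show "\<forall>\<^sub>F r in at_top. dist (u (r *\<^sub>R \<theta>) / r) 1 < e"
        using eventually_gt_at_top[of 0]
      proof eventually_elim
        case (elim r)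
        have "\<bar>u (r *\<^sub>R \<theta>) - u (r *\<^sub>R \<eta>)\<bar> \<le> norm (r *\<^sub>R \<theta> - r *\<^sub>R \<eta>)"
          using lip[of "r *\<^sub>R \<theta>" "r *\<^sub>R \<eta>"] lip[of "r *\<^sub>R \<eta>" "r *\<^sub>R \<theta>"]
          by (simp add: norm_minus_commute abs_le_iff)
        also have "\<dots> = r * dist \<eta> \<theta>"
          using elim(2) by (simp add: dist_norm norm_minus_commute flip: scaleR_diff_right)
        finally have "\<bar>u (r *\<^sub>R \<theta>) / r - u (r *\<^sub>R \<eta>) / r\<bar> \<le> dist \<eta> \<theta>"
          using elim(2) by (simp add: field_simps flip: diff_divide_distrib)
        then show ?case
          using elim(1) \<eta>(2) unfolding dist_real_def by linarith
      qed
    qed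
    ultimately show ?thesis
      by (simp add: lightlike_directions_def)
  qed
  then show ?thesis
    unfolding closure_subset_eq[symmetric] by (rule subsetI)
qed

section \<open>Comparison with hyperboloids\<close>

text \<open>
  The hypothesis says that \<open>(x0, t0)\<close> lies in the future of all null support hyperplanes of the graph.
  In each direction the graph is then eventually below the future light cone of this point. A
  sequence of points violating the conclusion has directions that accumulate, by compactness of the sphere, at
  some \<open>\<eta>\<close>, and a point \<open>y\<close> that witnesses the hypothesis for \<open>\<eta>\<close> contradicts the Lipschitz bound
  from \<open>y\<close>.
\<close>
lemma below_cone_outside_ball:
  fixes u :: "real ^ 'n \<Rightarrow> real"
  assumes lip: "\<And>x y. u x \<le> u y + norm (x - y)"
    and above: "\<And>\<theta>. norm \<theta> = 1 \<Longrightarrow> ereal (\<theta> \<bullet> x0 - t0) < null_support u \<theta>"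
  obtains \<rho> where "\<And>x. norm (x - x0) \<ge> \<rho> \<Longrightarrow> u x < t0 + norm (x - x0)"
proof (rule ccontr)
  assume "\<not> thesis"
  then have "\<exists>x. norm (x - x0) \<ge> real (Suc k) \<and> u x \<ge> t0 + norm (x - x0)" for k
    using that by (meson not_less)
  then obtain X where X: "\<And>k. norm (X k - x0) \<ge> real (Suc k)" "\<And>k. u (X k) \<ge> t0 + norm (X k - x0)"
    by metis
  define r where "r k = norm (X k - x0)" for k
  define \<theta> where "\<theta> k = (1 / r k) *\<^sub>R (X k - x0)" for k
  have r: "r k \<ge> real (Suc k)" "r k > 0" for k
    using X(1)[of k] less_le_trans[of 0 "real (Suc k)" "r k"] unfolding r_def by simp_all
  have \<theta>1: "norm (\<theta> k) = 1" for k
    using r(2)[of k] by (simp add: \<theta>_def r_def)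
  then have "\<theta> k \<in> sphere 0 1" for k
    by simp
  then obtain \<eta> \<sigma> where \<eta>: "\<eta> \<in> sphere 0 1" "strict_mono \<sigma>" "(\<theta> \<circ> \<sigma>) \<longlonglongrightarrow> \<eta>"
    using compact_imp_seq_compact[OF compact_sphere] unfolding seq_compact_def by metis
  obtain y where y: "\<eta> \<bullet> x0 - t0 < \<eta> \<bullet> y - u y"
    using above[of \<eta>] \<eta>(1) unfolding null_support_def less_SUP_iff by auto
  let ?z = "x0 - y"
  have bound: "t0 - \<theta> k \<bullet> ?z - (norm ?z)\<^sup>2 / 2 * inverse (real (Suc k)) \<le> u y" for k
  proof -
    have "X k - y = r k *\<^sub>R \<theta> k + ?z"
      using r(2)[of k] by (simp add: \<theta>_def)
    then have "norm (X k - y) \<le> r k + \<theta> k \<bullet> ?z + (norm ?z)\<^sup>2 / (2 * r k)"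
      using norm_scaleR_add_le[OF \<theta>1 r(2)] by metis
    moreover have "(norm ?z)\<^sup>2 / (2 * r k) \<le> (norm ?z)\<^sup>2 / (2 * real (Suc k))"
      using r[of k] by (intro divide_left_mono) auto
    moreover have "\<dots> = (norm ?z)\<^sup>2 / 2 * inverse (real (Suc k))"
      by (simp add: inverse_eq_divide)
    moreover have "t0 + r k \<le> u y + norm (X k - y)"
      using X(2)[of k] lip[of "X k" y] unfolding r_def by linarith
    ultimately show ?thesis
      by linarith
  qed
  have "(\<lambda>k. inverse (real (Suc (\<sigma> k)))) \<longlonglongrightarrow> 0"
    using LIMSEQ_subseq_LIMSEQ[OF LIMSEQ_inverse_real_of_nat \<eta>(2)] by (simp add: o_def)
  then have "(\<lambda>k. t0 - \<theta> (\<sigma> k) \<bullet> ?z - (norm ?z)\<^sup>2 / 2 * inverse (real (Suc (\<sigma> k))))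
      \<longlonglongrightarrow> t0 - \<eta> \<bullet> ?z - (norm ?z)\<^sup>2 / 2 * 0"
    using \<eta>(3) unfolding o_def by (intro tendsto_intros)
  then have "t0 - \<eta> \<bullet> ?z - (norm ?z)\<^sup>2 / 2 * 0 \<le> u y"
    by (rule LIMSEQ_le_const2) (intro exI[of _ 0] allI impI bound)
  then show False
    using y by (simp add: inner_diff_right)
qed

lemma has_derivative_hyperboloid:
  fixes x0 y :: "'a::real_inner"
  assumes R: "R > 0"
  defines "s \<equiv> (\<lambda>y. sqrt (R\<^sup>2 + (norm (y - x0))\<^sup>2))"
  shows "(s has_derivative (\<lambda>v. ((1 / s y) *\<^sub>R (y - x0)) \<bullet> v)) (at y)"
    and "((\<lambda>y. (1 / s y) *\<^sub>R (y - x0)) has_derivative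
           (\<lambda>v. (1 / s y) *\<^sub>R v - (((y - x0) \<bullet> v) / s y ^ 3) *\<^sub>R (y - x0))) (at y)"
proof -
  have pos: "R\<^sup>2 + (norm (y - x0))\<^sup>2 > 0"
    using R by (simp add: add_pos_nonneg)
  then have s: "s y > 0"
    by (simp add: s_def)
  have "((\<lambda>y. R\<^sup>2 + (y - x0) \<bullet> (y - x0)) has_derivative (\<lambda>v. 2 * ((y - x0) \<bullet> v))) (at y)"
    by (rule derivative_eq_intros refl)+ (simp add: inner_commute)
  then have 1: "((\<lambda>y. R\<^sup>2 + (norm (y - x0))\<^sup>2) has_derivative (\<lambda>v. 2 * ((y - x0) \<bullet> v))) (at y)"
    by (simp add: power2_norm_eq_inner)
  have "(s has_derivative (\<lambda>v. 2 * ((y - x0) \<bullet> v) * (inverse (s y) / 2))) (at y)"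
    unfolding s_def
    by (rule has_derivative_eq_rhs[OF DERIV_compose_FDERIV[OF DERIV_real_sqrt[OF pos] 1]]) auto
  then show ds: "(s has_derivative (\<lambda>v. ((1 / s y) *\<^sub>R (y - x0)) \<bullet> v)) (at y)"
    by (rule has_derivative_eq_rhs) (simp add: inverse_eq_divide)
  have "((\<lambda>y. inverse (s y)) has_derivative
      (\<lambda>v. - (inverse (s y) * (((1 / s y) *\<^sub>R (y - x0)) \<bullet> v) * inverse (s y)))) (at y)"
    using s by (intro Deriv.has_derivative_inverse ds) auto
  moreover have "((\<lambda>y. y - x0) has_derivative (\<lambda>v. v)) (at y)"
    by (auto intro!: derivative_eq_intros)
  ultimately have "((\<lambda>y. inverse (s y) *\<^sub>R (y - x0)) has_derivative
      (\<lambda>v. inverse (s y) *\<^sub>R v + (- (inverse (s y) * (((1 / s y) *\<^sub>R (y - x0)) \<bullet> v) * inverse (s y)))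
        *\<^sub>R (y - x0))) (at y)"
    by (rule has_derivative_scaleR)
  then show "((\<lambda>y. (1 / s y) *\<^sub>R (y - x0)) has_derivative
           (\<lambda>v. (1 / s y) *\<^sub>R v - (((y - x0) \<bullet> v) / s y ^ 3) *\<^sub>R (y - x0))) (at y)"
    unfolding inverse_eq_divide
    by (rule has_derivative_eq_rhs) (simp add: power3_eq_cube)
qed

text \<open>
  If a translate of the hyperboloid of radius \<open>R\<close>, which has mean curvature \<open>1 / R\<close>, touches the graph
  from above, then the gradients agree at the contact point and the Hessian \<open>D\<close> of \<open>u\<close> is at most the
  Hessian \<open>W\<close> of the hyperboloid. The mean curvature is the trace of the Hessian plus a nonnegative
  multiple of its value on the gradient, times a positive factor, so it is at most that of the hyperboloid.
\<close>
lemma mean_curvature_le_at_contact_with_hyperboloid: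
  fixes u :: "real ^ 'n \<Rightarrow> real"
  assumes du: "\<And>y. u differentiable (at y)" and less: "\<And>y. norm (gradient u y) < 1"
    and ddu: "gradient u differentiable (at x)" and R: "R > 0"
    and max: "\<And>y. u y - sqrt (R\<^sup>2 + (norm (y - x0))\<^sup>2) \<le> u x - sqrt (R\<^sup>2 + (norm (x - x0))\<^sup>2)"
  shows "mean_curvature (graph_of u) (x, u x) \<le> 1 / R"
proof -
  define s where "s = (\<lambda>y. sqrt (R\<^sup>2 + (norm (y - x0))\<^sup>2))"
  define q where "q = x - x0"
  define \<sigma> where "\<sigma> = s x"
  define W where "W = (\<lambda>v. (1 / \<sigma>) *\<^sub>R v - ((q \<bullet> v) / \<sigma> ^ 3) *\<^sub>R q)"
  let ?e = "\<lambda>i. axis i 1 :: real ^ 'n" and ?n = "real CARD('n)"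
  have \<sigma>: "\<sigma> > 0"
    using R by (simp add: \<sigma>_def s_def add_pos_nonneg)
  have \<sigma>2: "\<sigma>\<^sup>2 = R\<^sup>2 + q \<bullet> q"
    by (simp add: \<sigma>_def s_def q_def power2_norm_eq_inner)
  obtain D where D: "(gradient u has_derivative D) (at x)"
    using ddu by (auto simp: differentiable_def)
  let ?F = "\<lambda>y. gradient u y - (1 / s y) *\<^sub>R (y - x0)" and ?E = "\<lambda>v. D v - W v"
  have df: "((\<lambda>y. u y - s y) has_derivative (\<lambda>v. ?F y \<bullet> v)) (at y)" for y
    unfolding inner_diff_left s_def
    by (intro has_derivative_diff has_derivative_gradient[OF du] has_derivative_hyperboloid(1)[OF R])
  have dF: "(?F has_derivative ?E) (at x)"
    unfolding W_def \<sigma>_def q_def s_def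
    by (intro has_derivative_diff D has_derivative_hyperboloid(2)[OF R])
  have max': "u y - s y \<le> u x - s x" for y
    unfolding s_def by (rule max)
  have neg: "v \<bullet> ?E v \<le> 0" for v
    by (rule max_gradient_hessian(2)[OF df dF max'])
  have "?F x = 0"
    by (rule max_gradient_hessian(1)[OF df dF max'])
  then have a: "gradient u x = (1 / \<sigma>) *\<^sub>R q"
    by (simp add: \<sigma>_def q_def)
  define l where "l = 1 / sqrt (1 - (norm (gradient u x))\<^sup>2)"
  have "1 - (norm (gradient u x))\<^sup>2 = (R / \<sigma>)\<^sup>2"
  proof -
    have "(norm (gradient u x))\<^sup>2 = (q \<bullet> q) / \<sigma>\<^sup>2"
      using \<sigma> unfolding a power2_norm_eq_inner by (simp add: power2_eq_square)
    moreover have "1 - (q \<bullet> q) / \<sigma>\<^sup>2 = (\<sigma>\<^sup>2 - q \<bullet> q) / \<sigma>\<^sup>2"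
      using \<sigma> by (simp add: diff_divide_distrib)
    ultimately show ?thesis
      unfolding \<sigma>2[symmetric] by (simp add: \<sigma>2 power_divide)
  qed
  then have l: "l = \<sigma> / R"
    using R \<sigma> by (simp add: l_def)
  have "(\<Sum>i\<in>UNIV. D (?e i) $ i) \<le> (\<Sum>i\<in>UNIV. W (?e i) $ i)"
    using neg[of "?e _"] by (intro sum_mono) (simp add: inner_axis')
  also have "\<dots> = (\<Sum>i\<in>UNIV. 1 / \<sigma> - q $ i * q $ i / \<sigma> ^ 3)"
    by (simp add: W_def inner_axis)
  also have "\<dots> = ?n / \<sigma> - q \<bullet> q / \<sigma> ^ 3"
    by (simp add: sum_subtractf inner_vec_def sum_divide_distrib)
  finally have trace: "(\<Sum>i\<in>UNIV. D (?e i) $ i) \<le> ?n / \<sigma> - q \<bullet> q / \<sigma> ^ 3" .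
  have "gradient u x \<bullet> D (gradient u x) \<le> gradient u x \<bullet> W (gradient u x)"
    using neg[of "gradient u x"] by (simp add: inner_diff_right)
  \<comment> \<open>The terms \<open>q \<bullet> q / \<sigma> ^ 3\<close> cancel in the end: the hyperboloid has constant mean curvature.\<close>
  also have "\<dots> = (q \<bullet> q) / \<sigma> ^ 3 - (q \<bullet> q)\<^sup>2 / \<sigma> ^ 5"
    using \<sigma> by (simp add: a W_def inner_diff_right field_simps eval_nat_numeral)
  also have "\<dots> = (q \<bullet> q) * (\<sigma>\<^sup>2 - q \<bullet> q) / \<sigma> ^ 5"
    using \<sigma> by (simp add: field_simps eval_nat_numeral)
  also have "\<dots> = (q \<bullet> q) * R\<^sup>2 / \<sigma> ^ 5"
    by (simp add: \<sigma>2)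
  finally have "l\<^sup>2 * (gradient u x \<bullet> D (gradient u x)) \<le> l\<^sup>2 * ((q \<bullet> q) * R\<^sup>2 / \<sigma> ^ 5)"
    by (rule mult_left_mono) simp
  also have "\<dots> = q \<bullet> q / \<sigma> ^ 3"
    using R \<sigma> by (simp add: l field_simps eval_nat_numeral)
  finally have "(\<Sum>i\<in>UNIV. D (?e i) $ i) + l\<^sup>2 * (gradient u x \<bullet> D (gradient u x)) \<le> ?n / \<sigma>"
    using trace by linarith
  then have "l * ((\<Sum>i\<in>UNIV. D (?e i) $ i) + l\<^sup>2 * (gradient u x \<bullet> D (gradient u x))) \<le> l * (?n / \<sigma>)"
    using R \<sigma> by (intro mult_left_mono) (simp_all add: l)
  also have "\<dots> = ?n * (1 / R)"
    using \<sigma> by (simp add: l)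
  finally have "?n * mean_curvature (graph_of u) (x, u x) \<le> ?n * (1 / R)"
    using mean_curvature_graph[OF du less D] by (simp add: l_def)
  then show ?thesis
    by (subst (asm) mult_le_cancel_left_pos) auto
qed

text \<open>
  Compare the graph with the hyperboloid of radius \<open>R\<close> centred at \<open>(x0, t0)\<close>. It lies above the future
  light cone of \<open>(x0, t0)\<close>, hence above the graph outside a ball. If the graph reached the
  hyperboloid anywhere, a translate of the hyperboloid would touch it from above, which the
  larger mean curvature of the graph excludes. In particular the graph is below the hyperboloid over the centre.
\<close>
lemma height_less_if_mean_curvature_bounded_below:
  fixes u :: "real ^ 'n \<Rightarrow> real"
  assumes S: "spacelike_hypersurface (graph_of u)"
    and mc: "\<And>p. p \<in> graph_of u \<Longrightarrow> mean_curvature (graph_of u) p \<ge> H"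
    and R: "R > 0" "1 / R < H"
    and above: "\<And>\<theta>. norm \<theta> = 1 \<Longrightarrow> ereal (\<theta> \<bullet> x0 - t0) < null_support u \<theta>"
  shows "u x0 < t0 + R"
proof (rule ccontr)
  assume not_less: "\<not> u x0 < t0 + R"
  note du = spacelike_graph_differentiable[OF S]
    and less = spacelike_graph_norm_gradient_less_1[OF S]
  define f where "f = (\<lambda>y. u y - sqrt (R\<^sup>2 + (norm (y - x0))\<^sup>2))"
  obtain \<rho> where \<rho>: "\<And>x. norm (x - x0) \<ge> \<rho> \<Longrightarrow> u x < t0 + norm (x - x0)"
    using below_cone_outside_ball[OF gradient_less_1_imp_lipschitz[OF du less] above] by metis
  have fx0: "f x0 \<ge> t0"
    using not_less R(1) by (simp add: f_def)
  have far: "f y < t0" if "norm (y - x0) \<ge> \<rho>" for y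
  proof -
    have "norm (y - x0) \<le> sqrt (R\<^sup>2 + (norm (y - x0))\<^sup>2)"
      by (rule real_le_rsqrt) simp
    then show ?thesis
      using \<rho>[OF that] unfolding f_def by linarith
  qed
  then have "\<rho> > 0"
    using fx0 by (metis diff_self norm_zero not_le)
  moreover have "continuous_on (cball x0 \<rho>) f"
    unfolding f_def
    by (intro continuous_intros continuous_at_imp_continuous_on ballI
        differentiable_imp_continuous_within du)
  ultimately obtain x where x: "x \<in> cball x0 \<rho>" "\<And>y. y \<in> cball x0 \<rho> \<Longrightarrow> f y \<le> f x"
    using continuous_attains_sup[of "cball x0 \<rho>" f] by force
  have "f y \<le> f x" for y
  proof (cases "y \<in> cball x0 \<rho>")
    case False
    then have "f y < t0"
      by (intro far) (simp add: dist_norm norm_minus_commute)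
    also have "t0 \<le> f x"
      using fx0 x(2)[of x0] \<open>\<rho> > 0\<close> by simp
    finally show ?thesis
      by simp
  qed (rule x(2))
  then have "mean_curvature (graph_of u) (x, u x) \<le> 1 / R"
    unfolding f_def
    by (intro mean_curvature_le_at_contact_with_hyperboloid[OF du less
          spacelike_graph_gradient_differentiable[OF S] R(1)])
  moreover have "(x, u x) \<in> graph_of u"
    by (simp add: graph_of_def)
  ultimately show False
    using mc[of "(x, u x)"] R(2) by linarith
qed

text \<open>
  If \<open>\<eta>\<close> is at distance at least \<open>\<delta> > 0\<close> from all directions with finite null support, those directions satisfy
  \<open>\<theta> \<bullet> \<eta> \<le> c < 1\<close>. The point at height \<open>r * c + u 0 + 1\<close> over \<open>r *\<^sub>R \<eta>\<close> is then in the future of all null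
  support hyperplanes, so \<open>u\<close> grows along \<open>\<eta>\<close> with slope at most \<open>c\<close>, and \<open>\<eta>\<close> is not lightlike.
\<close>
lemma lightlike_directions_subset_closure:
  fixes u :: "real ^ 'n \<Rightarrow> real"
  assumes S: "spacelike_hypersurface (graph_of u)" and H: "H > 0"
    and mc: "\<And>p. p \<in> graph_of u \<Longrightarrow> mean_curvature (graph_of u) p \<ge> H"
  shows "lightlike_directions u \<subseteq> closure {\<theta> \<in> sphere 0 1. null_support u \<theta> < \<infinity>}"
proof (rule subsetI, rule ccontr)
  fix \<eta> assume \<eta>: "\<eta> \<in> lightlike_directions u"
    and "\<eta> \<notin> closure {\<theta> \<in> sphere 0 1. null_support u \<theta> < \<infinity>}"
  then obtain \<delta> where \<delta>: "\<delta> > 0"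
    "\<And>\<theta>. norm \<theta> = 1 \<Longrightarrow> null_support u \<theta> < \<infinity> \<Longrightarrow> dist \<theta> \<eta> \<ge> \<delta>"
    unfolding closure_approachable by (auto simp: not_less)
  have \<eta>1: "norm \<eta> = 1"
    using \<eta> by (simp add: lightlike_directions_def)
  define c where "c = 1 - \<delta>\<^sup>2 / 2"
  have cap: "\<theta> \<bullet> \<eta> \<le> c" if "norm \<theta> = 1" "null_support u \<theta> < \<infinity>" for \<theta>
  proof -
    have "\<delta>\<^sup>2 \<le> (norm (\<theta> - \<eta>))\<^sup>2"
      using \<delta>(1) \<delta>(2)[OF that] by (simp add: dist_norm)
    also have "\<dots> = 2 - 2 * (\<theta> \<bullet> \<eta>)"
      using that(1) \<eta>1 unfolding power2_norm_eq_inner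
      by (simp add: inner_diff_left inner_diff_right inner_commute norm_eq_1)
    finally show ?thesis
      by (simp add: c_def)
  qed
  \<comment> \<open>Any radius larger than \<open>1 / H\<close> serves.\<close>
  have R: "2 / H > 0" "1 / (2 / H) < H"
    using H by simp_all
  have growth: "u (r *\<^sub>R \<eta>) < r * c + (u 0 + 1 + 2 / H)" if r: "r > 0" for r
  proof -
    have "ereal (\<theta> \<bullet> (r *\<^sub>R \<eta>) - (r * c + u 0 + 1)) < null_support u \<theta>" if \<theta>: "norm \<theta> = 1" for \<theta>
    proof (cases "null_support u \<theta> < \<infinity>")
      case True
      have "r * (\<theta> \<bullet> \<eta>) \<le> r * c"
        using r cap[OF \<theta> True] by simp
      then have "ereal (\<theta> \<bullet> (r *\<^sub>R \<eta>) - (r * c + u 0 + 1)) < ereal (\<theta> \<bullet> 0 - u 0)"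
        by simp
      also have "\<dots> \<le> null_support u \<theta>"
        unfolding null_support_def by (rule SUP_upper) simp
      finally show ?thesis .
    qed simp
    from height_less_if_mean_curvature_bounded_below[OF S mc R this]
    show ?thesis
      by (simp add: add.assoc)
  qed
  have "((\<lambda>r. c + (u 0 + 1 + 2 / H) / r) \<longlongrightarrow> c + 0) at_top"
    by (intro tendsto_intros tendsto_divide_0[OF tendsto_const]
        filterlim_at_top_imp_at_infinity filterlim_ident)
  moreover have "((\<lambda>r. u (r *\<^sub>R \<eta>) / r) \<longlongrightarrow> 1) at_top"
    using \<eta> by (simp add: lightlike_directions_def)
  moreover have "\<forall>\<^sub>F r in at_top. u (r *\<^sub>R \<eta>) / r \<le> c + (u 0 + 1 + 2 / H) / r"
    using eventually_gt_at_top[of 0]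
  proof eventually_elim
    case (elim r)
    then have "u (r *\<^sub>R \<eta>) / r \<le> (r * c + (u 0 + 1 + 2 / H)) / r"
      using growth[of r] by (intro divide_right_mono) auto
    also have "\<dots> = c + (u 0 + 1 + 2 / H) / r"
      using elim by (simp add: add_divide_distrib)
    finally show ?case .
  qed
  ultimately have "1 \<le> c + 0"
    by (intro tendsto_le[OF trivial_limit_at_top_linorder])
  then show False
    using \<delta>(1) by (simp add: c_def)
qed

section \<open>Asymptotics of entire spacelike graphs\<close>

theorem proposition1p18:
  fixes u :: "real ^ 'n \<Rightarrow> real"
  assumes "spacelike_hypersurface (graph_of u)"
  shows "(\<forall>\<theta>\<in>lightlike_directions u.
            ((\<lambda>r. ereal (r - u (r *\<^sub>R \<theta>))) \<longlongrightarrow> asymptotic_offset u \<theta>) at_top \<and>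
            asymptotic_offset u \<theta> \<noteq> - \<infinity>) \<and>
         (\<forall>\<theta>\<in>sphere 0 1.
            null_support u \<theta> =
              (if \<theta> \<in> lightlike_directions u then asymptotic_offset u \<theta> else \<infinity>)) \<and>
         (\<forall>H>0. (\<forall>p\<in>graph_of u. mean_curvature (graph_of u) p \<ge> H) \<longrightarrow>
            lightlike_directions u = closure {\<theta> \<in> sphere 0 1. null_support u \<theta> < \<infinity>})"
proof -
  have lip: "u x \<le> u y + norm (x - y)" for x y
    by (rule gradient_less_1_imp_lipschitz[OF spacelike_graph_differentiable[OF assms]
          spacelike_graph_norm_gradient_less_1[OF assms]])
  have L1: "norm \<theta> = 1" if "\<theta> \<in> lightlike_directions u" for \<theta>
    using that by (simp add: lightlike_directions_def)
  have offset: "asymptotic_offset u \<theta> = null_support u \<theta>" if "norm \<theta> = 1" for \<theta>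
    unfolding asymptotic_offset_def
    by (rule tendsto_Lim[OF trivial_limit_at_top_linorder tendsto_null_support[OF lip that]])
  have inL: "\<theta> \<in> lightlike_directions u" if "norm \<theta> = 1" "null_support u \<theta> < \<infinity>" for \<theta>
    by (rule null_support_finite_imp_lightlike[OF lip that])
  show ?thesis
  proof (intro conjI ballI allI impI)
    fix \<theta> assume "\<theta> \<in> lightlike_directions u"
    then show "((\<lambda>r. ereal (r - u (r *\<^sub>R \<theta>))) \<longlongrightarrow> asymptotic_offset u \<theta>) at_top"
      using tendsto_null_support[OF lip] offset L1 by metis
  next
    fix \<theta> assume "\<theta> \<in> lightlike_directions u"
    then show "asymptotic_offset u \<theta> \<noteq> - \<infinity>"
      using null_support_gt_minus_infinity[of u \<theta>] offset L1 by force
  next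
    fix \<theta> :: "real ^ 'n" assume "\<theta> \<in> sphere 0 1"
    then show "null_support u \<theta> =
        (if \<theta> \<in> lightlike_directions u then asymptotic_offset u \<theta> else \<infinity>)"
      using offset[of \<theta>] inL[of \<theta>] by auto
  next
    fix H :: real
    assume "H > 0" "\<forall>p\<in>graph_of u. mean_curvature (graph_of u) p \<ge> H"
    then have "lightlike_directions u \<subseteq> closure {\<theta> \<in> sphere 0 1. null_support u \<theta> < \<infinity>}"
      using lightlike_directions_subset_closure[OF assms] by blast
    moreover have "closure {\<theta> \<in> sphere 0 1. null_support u \<theta> < \<infinity>} \<subseteq> lightlike_directions u"
      using inL by (intro closure_minimal closed_lightlike_directions lip) auto
    ultimately show "lightlike_directions u = closure {\<theta> \<in> sphere 0 1. null_support u \<theta> < \<infinity>}"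
      by blast
  qed
qed

end
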